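(* Assume $\mathsf{MA}_{\omega_1}$ (Martin's Axiom for $\omega_1$ many dense sets). Then every tower of length $\omega_1$ is Hausdorff.
   Context: For $A,B\subseteq\omega$ write $A\subseteq^* B$ if $A\setminus B$ is finite. A tower of length $\omega_1$ is a family $(T_\alpha)_{\alpha<\omega_1}$ of subsets of $\omega$ such that, for all $\alpha,\beta<\omega_1$, $T_\alpha\setminus T_\beta$ is finite if and only if $\alpha\le\beta$ (no maximality is assumed). A tower $(T_\alpha)_{\alpha<\omega_1}$ satisfies condition (H) if for each $\alpha<\omega_1$ and $n<\omega$ the set $\{\xi<\alpha : T_\xi\setminus T_\alpha\subseteq n\}$ is finite (here $n=\{0,\dots,n-1\}$). A tower $(T_\alpha)_{\alpha<\omega_1}$ is Hausdorff if it has a cofinal subtower satisfying (H), i.e. there is an uncountable $X\subseteq\omega_1$ such that $(T_\alpha)_{\alpha\in X}$, re-enumerated increasingly in order type $\omega_1$, satisfies (H). *)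

theory Defs
  imports Complex_Main "HOL-Library.Countable_Set_Type"
begin

section \<open>The ordinal \<open>\<omega>\<^sub>1\<close>\<close>

text \<open>\<^term>\<open>cardSuc natLeq\<close> is an initial well-order, hence its order type is the
  ordinal \<open>\<omega>\<^sub>1\<close>; \<open>omega1_uncountable\<close> and \<open>omega1_countable_lessThan\<close> below confirm this.\<close>

typedef omega1 = "Field (cardSuc natLeq)"
proof -
  have "Field (cardSuc natLeq) \<noteq> {}"
    using cardSuc_finite[OF natLeq_Card_order] Field_natLeq by fastforce
  then show ?thesis by blast
qed

instantiation omega1 :: wellorder
begin

definition "\<alpha> \<le> \<beta> \<longleftrightarrow> (Rep_omega1 \<alpha>, Rep_omega1 \<beta>) \<in> cardSuc natLeq"

definition "(\<alpha> :: omega1) < \<beta> \<longleftrightarrow> \<alpha> \<le> \<beta> \<and> \<not> \<beta> \<le> \<alpha>"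

instance
proof -
  let ?r = "cardSuc natLeq"
  have wo: "Well_order ?r"
    using cardSuc_Card_order[OF natLeq_Card_order] by (simp add: card_order_on_def)
  then have refl: "refl_on (Field ?r) ?r" and trans: "trans ?r" and antisym: "antisym ?r"
    and total: "total_on (Field ?r) ?r" and wf: "wf (?r - Id)"
    by (auto simp: order_on_defs)
  have less_iff: "\<alpha> < \<beta> \<longleftrightarrow> (Rep_omega1 \<alpha>, Rep_omega1 \<beta>) \<in> ?r - Id" for \<alpha> \<beta> :: omega1
    unfolding less_omega1_def less_eq_omega1_def
    using antisymD[OF antisym] refl_onD[OF refl Rep_omega1] by (metis DiffD1 DiffD2 DiffI pair_in_Id_conv)
  show "OFCLASS(omega1, wellorder_class)"
  proof
    fix \<alpha> \<beta> \<gamma> :: omega1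
    show "\<alpha> < \<beta> \<longleftrightarrow> \<alpha> \<le> \<beta> \<and> \<not> \<beta> \<le> \<alpha>" by (rule less_omega1_def)
    show "\<alpha> \<le> \<alpha>" unfolding less_eq_omega1_def by (rule refl_onD[OF refl Rep_omega1])
    show "\<alpha> \<le> \<beta> \<Longrightarrow> \<beta> \<le> \<gamma> \<Longrightarrow> \<alpha> \<le> \<gamma>"
      using trans unfolding less_eq_omega1_def by (rule transD)
    show "\<alpha> \<le> \<beta> \<Longrightarrow> \<beta> \<le> \<alpha> \<Longrightarrow> \<alpha> = \<beta>"
      using antisymD[OF antisym] unfolding less_eq_omega1_def by (simp flip: Rep_omega1_inject)
    show "\<alpha> \<le> \<beta> \<or> \<beta> \<le> \<alpha>"
      using total refl_onD[OF refl Rep_omega1[of \<alpha>]] Rep_omega1[of \<alpha>] Rep_omega1[of \<beta>]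
      unfolding less_eq_omega1_def total_on_def by (cases "Rep_omega1 \<alpha> = Rep_omega1 \<beta>") auto
  next
    fix P :: "omega1 \<Rightarrow> bool" and \<alpha> :: omega1
    assume step: "\<And>\<beta>. (\<And>\<gamma>. \<gamma> < \<beta> \<Longrightarrow> P \<gamma>) \<Longrightarrow> P \<beta>"
    have "wf (inv_image (?r - Id) Rep_omega1)" using wf by (rule wf_inv_image)
    then show "P \<alpha>"
    proof (induction \<alpha> rule: wf_induct_rule)
      case (less \<beta>)
      show ?case by (rule step, rule less) (simp add: less_iff inv_image_def)
    qed
  qed
qed

end

context
  includes cardinal_syntax
begin

lemma omega1_uncountable: "uncountable (UNIV :: omega1 set)"
proof
  assume "countable (UNIV :: omega1 set)"
  then have "countable (range Rep_omega1)" by blast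
  then have "countable (Field (cardSuc natLeq))"
    by (simp add: type_definition.Rep_range[OF type_definition_omega1])
  then have "|Field (cardSuc natLeq)| \<le>o natLeq" by (simp add: countable_card_le_natLeq)
  then have "cardSuc natLeq \<le>o natLeq"
    using card_of_Field_ordIso[OF cardSuc_Card_order[OF natLeq_Card_order]]
      ordIso_ordLeq_trans ordIso_symmetric by blast
  with cardSuc_greater[OF natLeq_Card_order] show False
    using not_ordLess_ordLeq by blast
qed

lemma omega1_countable_lessThan: "countable {..<\<alpha> :: omega1}"
proof -
  let ?r = "cardSuc natLeq"
  have "|underS ?r (Rep_omega1 \<alpha>)| <o ?r"
    using card_of_underS[OF cardSuc_Card_order[OF natLeq_Card_order] Rep_omega1] .
  then have "|underS ?r (Rep_omega1 \<alpha>)| \<le>o natLeq"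
    using cardSuc_ordLeq_ordLess[OF natLeq_Card_order card_of_Card_order] by blast
  then have "countable (underS ?r (Rep_omega1 \<alpha>))" by (simp add: countable_card_le_natLeq)
  moreover have "Rep_omega1 ` {..<\<alpha>} \<subseteq> underS ?r (Rep_omega1 \<alpha>)"
    by (auto simp: underS_def less_eq_omega1_def order_less_le Rep_omega1_inject)
  ultimately have "countable (Rep_omega1 ` {..<\<alpha>})" by (rule countable_subset[rotated])
  then show ?thesis
    by (rule countable_image_inj_on) (simp add: inj_on_def Rep_omega1_inject)
qed

end

section \<open>Martin's Axiom\<close>

text \<open>Throughout, \<^term>\<open>(p, q) \<in> le\<close> means that \<^term>\<open>p\<close> extends (is stronger than) \<^term>\<open>q\<close>.\<close>

definition compatible :: "'p set \<Rightarrow> 'p rel \<Rightarrow> 'p \<Rightarrow> 'p \<Rightarrow> bool" where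
  "compatible P le p q \<longleftrightarrow> (\<exists>r\<in>P. (r, p) \<in> le \<and> (r, q) \<in> le)"

definition ccc :: "'p set \<Rightarrow> 'p rel \<Rightarrow> bool" where
  "ccc P le \<longleftrightarrow>
     (\<forall>A\<subseteq>P. (\<forall>p\<in>A. \<forall>q\<in>A. p \<noteq> q \<longrightarrow> \<not> compatible P le p q) \<longrightarrow> countable A)"

definition dense_in :: "'p set \<Rightarrow> 'p rel \<Rightarrow> 'p set \<Rightarrow> bool" where
  "dense_in P le D \<longleftrightarrow> D \<subseteq> P \<and> (\<forall>p\<in>P. \<exists>d\<in>D. (d, p) \<in> le)"

definition filter_in :: "'p set \<Rightarrow> 'p rel \<Rightarrow> 'p set \<Rightarrow> bool" where
  "filter_in P le G \<longleftrightarrow>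
     G \<subseteq> P \<and> G \<noteq> {} \<and>
     (\<forall>p\<in>G. \<forall>q\<in>P. (p, q) \<in> le \<longrightarrow> q \<in> G) \<and>
     (\<forall>p\<in>G. \<forall>q\<in>G. \<exists>r\<in>G. (r, p) \<in> le \<and> (r, q) \<in> le)"

text \<open>\<open>MA\<^bsub>\<omega>\<^sub>1\<^esub>\<close> for all partial orders whose conditions are elements of the type \<open>'p\<close>, as HOL
  cannot quantify over types inside a formula. This is the full axiom only if \<open>'p\<close> is large
  enough: over a finite type it is trivially true, so it has to be used together with an
  injection from \<^typ>\<open>omega1\<close> into \<open>'p\<close>.\<close>

definition MA_omega1 :: "'p itself \<Rightarrow> bool" where
  "MA_omega1 _ \<longleftrightarrow>
     (\<forall>(P :: 'p set) le (D :: omega1 \<Rightarrow> 'p set).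
        P \<noteq> {} \<longrightarrow> partial_order_on P le \<longrightarrow> ccc P le \<longrightarrow> (\<forall>\<alpha>. dense_in P le (D \<alpha>)) \<longrightarrow>
        (\<exists>G. filter_in P le G \<and> (\<forall>\<alpha>. G \<inter> D \<alpha> \<noteq> {})))"

section \<open>Towers\<close>

definition tower :: "(omega1 \<Rightarrow> nat set) \<Rightarrow> bool" where
  "tower T \<longleftrightarrow> (\<forall>\<alpha> \<beta>. finite (T \<alpha> - T \<beta>) \<longleftrightarrow> \<alpha> \<le> \<beta>)"

definition condition_H :: "(omega1 \<Rightarrow> nat set) \<Rightarrow> bool" where
  "condition_H T \<longleftrightarrow> (\<forall>\<alpha> n. finite {\<xi>. \<xi> < \<alpha> \<and> T \<xi> - T \<alpha> \<subseteq> {..<n}})"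

text \<open>\<open>e\<close> is the increasing enumeration of the cofinal index set \<open>X\<close>.\<close>

definition hausdorff_tower :: "(omega1 \<Rightarrow> nat set) \<Rightarrow> bool" where
  "hausdorff_tower T \<longleftrightarrow>
     tower T \<and>
     (\<exists>X e. uncountable X \<and> strict_mono e \<and> range e = X \<and> condition_H (\<lambda>\<alpha>. T (e \<alpha>)))"

end

theory Submission
  imports Defs "HOL-Algebra.Free_Abelian_Groups"
begin

text \<open>The witness \<open>X\<close> is added by a ccc partial order with finite conditions. A condition \<open>(F, n)\<close>
  says that the finite set \<open>F\<close> is part of \<open>X\<close>, and promises that every index \<open>\<xi>\<close> that joins later
  and lies below some \<open>\<alpha> \<in> F\<close> does not satisfy \<open>T\<^sub>\<xi> - T\<^sub>\<alpha> \<subseteq> n\<close>. Hence, once \<open>(F, n)\<close> is in the generic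
  filter, the set \<open>{\<xi> \<in> X. \<xi> < \<alpha> \<and> T\<^sub>\<xi> - T\<^sub>\<alpha> \<subseteq> n}\<close> is contained in \<open>F\<close> for each \<open>\<alpha> \<in> F\<close>, which is
  condition (H) at \<open>\<alpha>\<close> and \<open>n\<close> (\<open>finite_traces_in_filter_union\<close>). The number can always be increased,
  and an index above all of \<open>F\<close> can always be added, as the promise only restricts indices below
  members of \<open>F\<close>. So \<open>\<omega>\<^sub>1\<close> many dense sets make \<open>X\<close> unbounded and give every \<open>n\<close>
  (\<open>dense_in_hausdorff_le\<close>).

  The point is the countable chain condition (\<open>ccc_hausdorff_le\<close>). Thin an uncountable set of
  conditions until all have the same \<open>n\<close>, their sets \<open>F\<close> share a root \<open>R\<close>, and the remainders
  \<open>F - R\<close> lie above \<open>R\<close>. Write \<open>a p\<close> and \<open>b p\<close> for the least and the greatest element of the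
  remainder of \<open>p\<close>; thin again so that one number \<open>N \<ge> n\<close> bounds all the finite differences
  \<open>T\<^sub>\<alpha> - T\<^sub>\<beta>\<close> with \<open>\<alpha> \<le> \<beta>\<close> in the same remainder. Then \<open>p\<close> and \<open>q\<close> with \<open>b p < a q\<close> are
  compatible as soon as a single \<open>m \<ge> N\<close> lies in \<open>T\<close> at \<open>a p\<close> but not in \<open>T\<close> at \<open>b q\<close>: beyond
  \<open>N\<close>, the former set is the smallest of those of \<open>p\<close> and the latter the largest of those of \<open>q\<close>.
  Such a pair exists (\<open>tower_escapes_unbounded_family\<close>): otherwise the union of all sets \<open>T\<close> at
  \<open>a p\<close> is, beyond \<open>N\<close>, already reached by countably many \<open>p\<close>, thus contained in \<open>T\<close> at a single
  \<open>b q\<close>, and the tower stops growing there.\<close>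

section \<open>Uncountable families and unbounded sets of countable ordinals\<close>

lemma uncountable_fibre:
  fixes g :: "'a \<Rightarrow> 'b::countable"
  assumes "uncountable A"
  obtains c where "uncountable {p \<in> A. g p = c}"
proof (rule ccontr)
  assume "\<not> thesis"
  then have "countable (\<Union>c. {p \<in> A. g p = c})" using that by (intro countable_UN) auto
  moreover have "(\<Union>c. {p \<in> A. g p = c}) = A" by auto
  ultimately show False using assms by simp
qed

lemma countable_imp_bounded_omega1:
  fixes B :: "omega1 set"
  assumes "countable B"
  obtains \<gamma> where "\<And>\<beta>. \<beta> \<in> B \<Longrightarrow> \<beta> < \<gamma>"
proof -
  have "countable {..\<beta>}" for \<beta> :: omega1
    using omega1_countable_lessThan[of \<beta>] by (simp flip: ivl_disj_un_singleton(2))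
  then have "countable (\<Union>\<beta>\<in>B. {..\<beta>})" using assms by blast
  then obtain \<gamma> where "\<gamma> \<notin> (\<Union>\<beta>\<in>B. {..\<beta>})" using omega1_uncountable by (metis UNIV_eq_I)
  then show ?thesis using that[of \<gamma>] by (auto simp: not_le)
qed

text \<open>An unbounded set contains a strictly increasing \<open>\<omega>\<^sub>1\<close>-sequence: by recursion, the countably
  many earlier values are bounded, so there is always a next one.\<close>

lemma strict_mono_into_unbounded_omega1:
  fixes X :: "omega1 set"
  assumes "\<And>\<gamma>. \<exists>x\<in>X. \<gamma> < x"
  shows "\<exists>e :: omega1 \<Rightarrow> omega1. strict_mono e \<and> range e \<subseteq> X"
proof -
  have "\<exists>e :: omega1 \<Rightarrow> omega1. \<forall>\<alpha>. e \<alpha> \<in> X \<and> (\<forall>\<beta><\<alpha>. e \<beta> < e \<alpha>)"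
  proof (rule dependent_wellorder_choice[where P = "\<lambda>e \<alpha> x. x \<in> X \<and> (\<forall>\<beta><\<alpha>. e \<beta> < x)"])
    fix \<alpha> and e :: "omega1 \<Rightarrow> omega1"
    have "countable (e ` {..<\<alpha>})" using omega1_countable_lessThan by blast
    then obtain \<gamma> where \<gamma>: "\<And>\<beta>. \<beta> \<in> e ` {..<\<alpha>} \<Longrightarrow> \<beta> < \<gamma>"
      using countable_imp_bounded_omega1 by blast
    then obtain x where "x \<in> X" "\<gamma> < x" using assms by blast
    with \<gamma> show "\<exists>x. x \<in> X \<and> (\<forall>\<beta><\<alpha>. e \<beta> < x)" by (meson imageI lessThan_iff less_trans)
  qed auto
  then show ?thesis by (auto simp: strict_mono_def)
qed

text \<open>This replaces the \<open>\<Delta>\<close>-system lemma: instead of meeting pairwise in exactly \<open>R\<close>, the sets of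
  the subfamily cover each point outside \<open>R\<close> only countably often. After fixing the cardinality
  \<open>k\<close> of the sets, take for \<open>R\<close> a largest finite set that is contained in uncountably many of
  them; by maximality no further point can belong to uncountably many of those.\<close>

lemma uncountable_family_root:
  fixes F :: "'i \<Rightarrow> 'a set"
  assumes unc: "uncountable A" and fin: "\<And>p. p \<in> A \<Longrightarrow> finite (F p)"
  obtains R A' where "finite R" "A' \<subseteq> A" "uncountable A'"
    "\<And>p. p \<in> A' \<Longrightarrow> R \<subseteq> F p" "\<And>x. x \<notin> R \<Longrightarrow> countable {p \<in> A'. x \<in> F p}"
proof -
  obtain k where k: "uncountable {p \<in> A. card (F p) = k}" (is "uncountable ?A0")
    using uncountable_fibre[OF unc, of "\<lambda>p. card (F p)"] by blast
  let ?Q = "\<lambda>R. finite R \<and> uncountable {p \<in> ?A0. R \<subseteq> F p}"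
  have "card R \<le> k" if "?Q R" for R
  proof -
    have "{p \<in> ?A0. R \<subseteq> F p} \<noteq> {}" using that by (metis countable_empty)
    then show ?thesis using fin by (auto intro: card_mono)
  qed
  moreover have "?Q {}" using k by simp
  ultimately have "\<exists>R. ?Q R \<and> (\<forall>S. ?Q S \<longrightarrow> card S \<le> card R)"
    by (intro Lattices_Big.ex_has_greatest_nat[where k = "{}" and b = "Suc k"]) (simp_all add: less_Suc_eq_le)
  then obtain R where R: "?Q R" and max: "\<And>S. ?Q S \<Longrightarrow> card S \<le> card R"
    by blast
  show ?thesis
  proof (rule that[of R "{p \<in> ?A0. R \<subseteq> F p}"])
    fix x assume "x \<notin> R"
    then have "card (insert x R) > card R" using R by simp
    then have "\<not> ?Q (insert x R)" using max by (meson not_le)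
    then have "countable {p \<in> ?A0. insert x R \<subseteq> F p}" using R by blast
    then show "countable {p \<in> {p \<in> ?A0. R \<subseteq> F p}. x \<in> F p}"
      by (rule countable_subset[rotated]) auto
  qed (use R in auto)
qed

section \<open>Martin's Axiom for conditions of another type\<close>

text \<open>\<^const>\<open>MA_omega1\<close> speaks about one type of conditions only. A partial order whose carrier
  injects into that type has an isomorphic copy there, and a filter of the copy pulls back.\<close>

lemma MA_omega1_transfer:
  fixes f :: "'a \<Rightarrow> 'p" and le :: "'a rel" and D :: "omega1 \<Rightarrow> 'a set"
  assumes MA: "MA_omega1 TYPE('p)" and inj: "inj_on f P"
    and ne: "P \<noteq> {}" and po: "partial_order_on P le" and ccc: "ccc P le"
    and dense: "\<And>\<alpha>. dense_in P le (D \<alpha>)"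
  obtains G where "filter_in P le G" "\<And>\<alpha>. G \<inter> D \<alpha> \<noteq> {}"
proof -
  define le' where "le' = map_prod f f ` le"
  have sub: "le \<subseteq> P \<times> P" and rf: "refl_on P le" and tr: "trans le" and an: "antisym le"
    using po by (auto simp: partial_order_on_def preorder_on_def)
  have le'_iff: "(f p, f q) \<in> le' \<longleftrightarrow> (p, q) \<in> le" if "p \<in> P" "q \<in> P" for p q
  proof
    assume "(f p, f q) \<in> le'"
    then obtain x y where xy: "(x, y) \<in> le" "f x = f p" "f y = f q" by (auto simp: le'_def)
    then have "x \<in> P" "y \<in> P" using sub by auto
    with xy that have "x = p" "y = q" using inj_onD[OF inj] by blast+
    with xy show "(p, q) \<in> le" by simp
  qed (force simp: le'_def)
  have le'_sub: "le' \<subseteq> f ` P \<times> f ` P" using sub by (auto simp: le'_def)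
  have "f ` P \<noteq> {}" using ne by simp
  moreover have "partial_order_on (f ` P) le'"
    unfolding partial_order_on_def preorder_on_def
  proof (intro conjI)
    show "refl_on (f ` P) le'" using rf le'_iff by (auto simp: refl_on_def)
    show "trans le'"
    proof (rule transI)
      fix x y z assume "(x, y) \<in> le'" "(y, z) \<in> le'"
      then obtain p q r where "x = f p" "y = f q" "z = f r" "p \<in> P" "q \<in> P" "r \<in> P"
        using le'_sub by blast
      with \<open>(x, y) \<in> le'\<close> \<open>(y, z) \<in> le'\<close> show "(x, z) \<in> le'" using le'_iff tr by (metis transD)
    qed
    show "antisym le'"
    proof (rule antisymI)
      fix x y assume "(x, y) \<in> le'" "(y, x) \<in> le'"
      then obtain p q where "x = f p" "y = f q" "p \<in> P" "q \<in> P"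
        using le'_sub by blast
      with \<open>(x, y) \<in> le'\<close> \<open>(y, x) \<in> le'\<close> show "x = y" using le'_iff an by (metis antisymD)
    qed
  qed (rule le'_sub)
  moreover have "ccc (f ` P) le'"
    unfolding ccc_def
  proof (intro allI impI)
    fix A assume A: "A \<subseteq> f ` P" and
      anti: "\<forall>x\<in>A. \<forall>y\<in>A. x \<noteq> y \<longrightarrow> \<not> compatible (f ` P) le' x y"
    obtain B where B: "B \<subseteq> P" "A = f ` B" using A by (meson subset_imageE)
    have "\<not> compatible P le p q" if "p \<in> B" "q \<in> B" "p \<noteq> q" for p q
    proof
      assume "compatible P le p q"
      then have "compatible (f ` P) le' (f p) (f q)"
        using that B le'_iff unfolding compatible_def by blast
      moreover have "f p \<noteq> f q" using that B inj by (meson inj_onD subsetD)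
      ultimately show False using anti B that by blast
    qed
    then have "countable B" using ccc B unfolding ccc_def by blast
    then show "countable A" using B by blast
  qed
  moreover have "\<forall>\<alpha>. dense_in (f ` P) le' (f ` D \<alpha>)"
  proof
    fix \<alpha>
    have "D \<alpha> \<subseteq> P" "\<forall>p\<in>P. \<exists>d\<in>D \<alpha>. (d, p) \<in> le"
      using dense[of \<alpha>] by (auto simp: dense_in_def)
    then show "dense_in (f ` P) le' (f ` D \<alpha>)"
      unfolding dense_in_def using le'_iff by blast
  qed
  ultimately have "\<exists>G. filter_in (f ` P) le' G \<and> (\<forall>\<alpha>. G \<inter> f ` D \<alpha> \<noteq> {})"
    by (intro MA[unfolded MA_omega1_def, rule_format]) auto
  then obtain G where G: "filter_in (f ` P) le' G" "\<forall>\<alpha>. G \<inter> f ` D \<alpha> \<noteq> {}"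
    by blast
  obtain H where H: "H \<subseteq> P" "G = f ` H"
    using G by (meson filter_in_def subset_imageE)
  have memH: "f p \<in> G \<longleftrightarrow> p \<in> H" if "p \<in> P" for p
    using H that inj by (auto simp: inj_on_def)
  show ?thesis
  proof (rule that)
    show "filter_in P le H"
      unfolding filter_in_def
    proof (intro conjI ballI impI)
      show "H \<noteq> {}" using G H by (auto simp: filter_in_def)
    next
      fix p q assume "p \<in> H" "q \<in> P" "(p, q) \<in> le"
      then show "q \<in> H" using G H memH le'_iff unfolding filter_in_def by (meson image_eqI subsetD)
    next
      fix p q assume pq: "p \<in> H" "q \<in> H"
      then have "\<exists>r\<in>G. (r, f p) \<in> le' \<and> (r, f q) \<in> le'" using G H unfolding filter_in_def by blast
      then show "\<exists>r\<in>H. (r, p) \<in> le \<and> (r, q) \<in> le" using H pq le'_iff by blast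
    qed (rule H)
    fix \<alpha>
    obtain d where "d \<in> D \<alpha>" "f d \<in> G" using G by blast
    moreover have "D \<alpha> \<subseteq> P" using dense by (auto simp: dense_in_def)
    ultimately show "H \<inter> D \<alpha> \<noteq> {}" using memH by blast
  qed
qed

section \<open>Towers\<close>

lemma tower_finite_diff_iff:
  "tower T \<Longrightarrow> finite (T \<alpha> - T \<beta>) \<longleftrightarrow> \<alpha> \<le> \<beta>"
  by (simp add: tower_def)

text \<open>The combinatorial core. In the application \<open>a p\<close> and \<open>b p\<close> are the least and the greatest
  index of a condition \<open>p\<close>. If no such \<open>m\<close> existed, then \<open>U\<close>, the part beyond \<open>N\<close> of the
  union of all \<open>T (a p)\<close>, would be contained in a single \<open>T (b q)\<close>, because countably many
  \<open>p\<close> suffice to witness the elements of \<open>U\<close> and some \<open>a q\<close> exceeds their \<open>b p\<close>. Every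
  \<open>T (a r)\<close> would then be almost contained in \<open>T (b q)\<close>, also for \<open>a r > b q\<close>.\<close>

lemma tower_escapes_unbounded_family:
  fixes a b :: "'i \<Rightarrow> omega1"
  assumes T: "tower T" and unb: "\<And>\<gamma>. \<exists>p\<in>A. \<gamma> < a p"
  obtains p q m where "p \<in> A" "q \<in> A" "b p < a q" "m \<in> T (a p)" "m \<notin> T (b q)" "N \<le> m"
proof (rule ccontr)
  note found = that
  assume "\<not> thesis"
  then have almost: "m \<in> T (b q)" if "p \<in> A" "q \<in> A" "b p < a q" "m \<in> T (a p)" "N \<le> m" for p q m
    using found that by blast
  define U where "U = (\<Union>p\<in>A. T (a p)) - {..<N}"
  have "\<forall>m\<in>U. \<exists>p. p \<in> A \<and> m \<in> T (a p)" by (auto simp: U_def)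
  then obtain w where w: "\<And>m. m \<in> U \<Longrightarrow> w m \<in> A \<and> m \<in> T (a (w m))" by metis
  have "countable ((\<lambda>m. b (w m)) ` U)" by (intro countable_image countableI_type)
  then obtain \<gamma> where \<gamma>: "\<And>\<beta>. \<beta> \<in> (\<lambda>m. b (w m)) ` U \<Longrightarrow> \<beta> < \<gamma>"
    using countable_imp_bounded_omega1 by blast
  obtain q where q: "q \<in> A" "\<gamma> < a q" using unb by blast
  have U_sub: "U \<subseteq> T (b q)"
  proof
    fix m assume m: "m \<in> U"
    then have "b (w m) < a q" using \<gamma> q by (meson imageI less_trans)
    moreover have "N \<le> m" using m by (simp add: U_def)
    ultimately show "m \<in> T (b q)" using almost w m q by blast
  qed
  obtain r where r: "r \<in> A" "b q < a r" using unb by blast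
  have "T (a r) - T (b q) \<subseteq> {..<N}" using U_sub r by (auto simp: U_def)
  then have "a r \<le> b q" using tower_finite_diff_iff[OF T] finite_subset by blast
  with r show False by simp
qed

lemma tower_uniform_modulus:
  assumes T: "tower T" and F: "finite F"
  obtains N where "\<And>\<alpha> \<beta> m. \<alpha> \<in> F \<Longrightarrow> \<beta> \<in> F \<Longrightarrow> \<alpha> \<le> \<beta> \<Longrightarrow> m \<in> T \<alpha> \<Longrightarrow> m \<notin> T \<beta> \<Longrightarrow> m < N"
proof -
  have "finite (\<Union>\<alpha>\<in>F. \<Union>\<beta>\<in>{\<beta> \<in> F. \<alpha> \<le> \<beta>}. T \<alpha> - T \<beta>)"
    using F tower_finite_diff_iff[OF T] by (intro finite_UN_I) auto
  then obtain N where "(\<Union>\<alpha>\<in>F. \<Union>\<beta>\<in>{\<beta> \<in> F. \<alpha> \<le> \<beta>}. T \<alpha> - T \<beta>) \<subseteq> {..<N}"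
    by (meson finite_nat_iff_bounded)
  then show ?thesis by (intro that[of N]) blast
qed

section \<open>The partial order of finite approximations\<close>

definition hausdorff_conditions :: "(omega1 set \<times> nat) set" where
  "hausdorff_conditions = Fpow UNIV \<times> UNIV"

text \<open>The promise of \<open>(F, n)\<close> concerns only indices added below a member of \<open>F\<close>. Indices above
  all of \<open>F\<close> are unrestricted, which is what keeps the final set unbounded.\<close>

definition hausdorff_le :: "(omega1 \<Rightarrow> nat set) \<Rightarrow> (omega1 set \<times> nat) rel" where
  "hausdorff_le T = {((F', n'), (F, n)). finite F' \<and> F \<subseteq> F' \<and> n \<le> n' \<and>
     (\<forall>\<xi>\<in>F' - F. \<forall>\<alpha>\<in>F. \<xi> < \<alpha> \<longrightarrow> \<not> T \<xi> - T \<alpha> \<subseteq> {..<n})}"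

lemma hausdorff_conditions_iff [simp]: "(F, n) \<in> hausdorff_conditions \<longleftrightarrow> finite F"
  by (simp add: hausdorff_conditions_def Fpow_def)

lemma hausdorff_le_iff:
  "((F', n'), (F, n)) \<in> hausdorff_le T \<longleftrightarrow> finite F' \<and> F \<subseteq> F' \<and> n \<le> n' \<and>
     (\<forall>\<xi>\<in>F' - F. \<forall>\<alpha>\<in>F. \<xi> < \<alpha> \<longrightarrow> \<not> T \<xi> - T \<alpha> \<subseteq> {..<n})"
  by (simp add: hausdorff_le_def)

lemma partial_order_on_hausdorff_le:
  "partial_order_on hausdorff_conditions (hausdorff_le T)"
  unfolding partial_order_on_def preorder_on_def
proof (intro conjI)
  show "hausdorff_le T \<subseteq> hausdorff_conditions \<times> hausdorff_conditions"
    by (auto simp: hausdorff_le_iff) (metis finite_subset)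
  show "refl_on hausdorff_conditions (hausdorff_le T)"
    by (auto simp: refl_on_def hausdorff_le_iff)
  show "antisym (hausdorff_le T)"
    by (auto simp: antisym_def hausdorff_le_iff)
  show "trans (hausdorff_le T)"
  proof (rule transI)
    fix p q r assume pq: "(p, q) \<in> hausdorff_le T" and qr: "(q, r) \<in> hausdorff_le T"
    obtain F n F' n' F'' n'' where eq: "p = (F'', n'')" "q = (F', n')" "r = (F, n)"
      by (metis surj_pair)
    have "\<not> T \<xi> - T \<alpha> \<subseteq> {..<n}" if "\<xi> \<in> F'' - F" "\<alpha> \<in> F" "\<xi> < \<alpha>" for \<xi> \<alpha>
    proof (cases "\<xi> \<in> F'")
      case True
      then show ?thesis using qr that by (simp add: eq hausdorff_le_iff)
    next
      case False
      have "n \<le> n'" "\<alpha> \<in> F'" using qr that by (auto simp: eq hausdorff_le_iff)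
      moreover from this have "\<not> T \<xi> - T \<alpha> \<subseteq> {..<n'}"
        using pq that False by (simp add: eq hausdorff_le_iff)
      ultimately show ?thesis by (meson lessThan_subset_iff subset_trans)
    qed
    then show "(p, r) \<in> hausdorff_le T"
      using pq qr by (auto simp: eq hausdorff_le_iff)
  qed
qed

text \<open>Two conditions with the same \<open>n\<close> and a common root, whose remainders lie above the root and
  one above the other, can only fail to be compatible because of an index \<open>\<xi>\<close> in the lower remainder and an
  \<open>\<alpha>\<close> in the upper one with \<open>T \<xi> - T \<alpha> \<subseteq> {..<n}\<close>. One element \<open>m\<close> of
  \<open>T (a p) - T (b q)\<close> that is large enough excludes all these pairs at once.\<close>

lemma ccc_hausdorff_le:
  assumes T: "tower T"
  shows "ccc hausdorff_conditions (hausdorff_le T)"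
  unfolding ccc_def
proof (intro allI impI, rule ccontr)
  fix A assume A: "A \<subseteq> hausdorff_conditions" and unc: "uncountable A"
    and anti: "\<forall>p\<in>A. \<forall>q\<in>A. p \<noteq> q \<longrightarrow> \<not> compatible hausdorff_conditions (hausdorff_le T) p q"
  have fin: "finite (fst p)" if "p \<in> A" for p
    using A that by (cases p) auto
  obtain R A1 where R: "finite R" and A1: "A1 \<subseteq> A" "uncountable A1"
    and root: "\<And>p. p \<in> A1 \<Longrightarrow> R \<subseteq> fst p"
    and point: "\<And>x. x \<notin> R \<Longrightarrow> countable {p \<in> A1. x \<in> fst p}"
    by (rule uncountable_family_root[OF unc, of fst], erule fin, rule that)
  have low: "countable {p \<in> A1. \<exists>x\<in>fst p - R. x < \<gamma>}" for \<gamma>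
  proof -
    have "countable (\<Union>x\<in>{..<\<gamma>} - R. {p \<in> A1. x \<in> fst p})"
      using point omega1_countable_lessThan by (intro countable_UN) auto
    then show ?thesis by (rule countable_subset[rotated]) auto
  qed
  (* Only countably many conditions equal the root or have a remainder reaching below a bound of R. *)
  obtain \<rho> where \<rho>: "\<And>\<beta>. \<beta> \<in> R \<Longrightarrow> \<beta> < \<rho>"
    using countable_imp_bounded_omega1[OF countable_finite[OF R]] by blast
  define A2 where "A2 = {p \<in> A1. fst p \<noteq> R \<and> (\<forall>x\<in>fst p - R. \<rho> \<le> x)}"
  have cover: "A1 \<subseteq> A2 \<union> ({R} \<times> UNIV \<union> {p \<in> A1. \<exists>x\<in>fst p - R. x < \<rho>})"
  proof
    fix p assume "p \<in> A1"
    then have "p \<in> A2 \<or> fst p = R \<or> (\<exists>x\<in>fst p - R. x < \<rho>)"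
      unfolding A2_def using not_le by blast
    with \<open>p \<in> A1\<close> show "p \<in> A2 \<union> ({R} \<times> UNIV \<union> {p \<in> A1. \<exists>x\<in>fst p - R. x < \<rho>})"
      by (cases p) auto
  qed
  have "countable ({R} \<times> (UNIV :: nat set))" by (rule countable_SIGMA) (auto intro: countable_finite)
  then have small: "countable ({R} \<times> UNIV \<union> {p \<in> A1. \<exists>x\<in>fst p - R. x < \<rho>})"
    using low[of \<rho>] by (rule countable_Un)
  have A2: "uncountable A2"
    using A1(2) countable_subset[OF cover countable_Un[OF _ small]] by blast
  have "\<forall>p\<in>A2. \<exists>N. \<forall>\<alpha>\<in>fst p. \<forall>\<beta>\<in>fst p. \<alpha> \<le> \<beta> \<longrightarrow> (\<forall>m. m \<in> T \<alpha> \<longrightarrow> m \<notin> T \<beta> \<longrightarrow> m < N)"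
  proof
    fix p assume "p \<in> A2"
    then have "p \<in> A" using A1(1) by (auto simp: A2_def)
    then have "finite (fst p)" by (rule fin)
    from tower_uniform_modulus[OF T this]
    show "\<exists>N. \<forall>\<alpha>\<in>fst p. \<forall>\<beta>\<in>fst p. \<alpha> \<le> \<beta> \<longrightarrow> (\<forall>m. m \<in> T \<alpha> \<longrightarrow> m \<notin> T \<beta> \<longrightarrow> m < N)"
      by metis
  qed
  then obtain N where N: "\<And>p \<alpha> \<beta> m. p \<in> A2 \<Longrightarrow> \<alpha> \<in> fst p \<Longrightarrow> \<beta> \<in> fst p \<Longrightarrow> \<alpha> \<le> \<beta> \<Longrightarrow>
      m \<in> T \<alpha> \<Longrightarrow> m \<notin> T \<beta> \<Longrightarrow> m < N p"
    by metis
  obtain c where "uncountable {p \<in> A2. (N p, snd p) = c}"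
    by (rule uncountable_fibre[OF A2, of "\<lambda>p. (N p, snd p)"]) (rule that)
  then obtain K n where A3: "uncountable {p \<in> A2. N p = K \<and> snd p = n}" (is "uncountable ?A3")
    by (cases c) simp
  define a where "a p = Min (fst p - R)" for p :: "omega1 set \<times> nat"
  define b where "b p = Max (fst p - R)" for p :: "omega1 set \<times> nat"
  have ab: "a p \<in> fst p - R" "b p \<in> fst p - R" "\<And>x. x \<in> fst p - R \<Longrightarrow> a p \<le> x \<and> x \<le> b p"
    if "p \<in> A2" for p
  proof -
    have "p \<in> A1" "fst p \<noteq> R" using that by (auto simp: A2_def)
    then have "finite (fst p - R)" "fst p - R \<noteq> {}"
      using fin A1(1) root by blast+
    then show "a p \<in> fst p - R" "b p \<in> fst p - R" "\<And>x. x \<in> fst p - R \<Longrightarrow> a p \<le> x \<and> x \<le> b p"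
      unfolding a_def b_def using Min_in Max_in by auto
  qed
  have unb: "\<exists>p\<in>?A3. \<gamma> < a p" for \<gamma>
  proof (rule ccontr)
    assume *: "\<not> ?thesis"
    obtain \<gamma>' where \<gamma>': "\<gamma> < \<gamma>'" using countable_imp_bounded_omega1[of "{\<gamma>}"] by auto
    have "?A3 \<subseteq> {p \<in> A1. \<exists>x\<in>fst p - R. x < \<gamma>'}"
    proof
      fix p assume p: "p \<in> ?A3"
      then have "p \<in> A1" "a p \<in> fst p - R" using ab(1) by (simp_all add: A2_def)
      moreover have "a p < \<gamma>'" using * p \<gamma>' by (meson le_less_trans not_le)
      ultimately show "p \<in> {p \<in> A1. \<exists>x\<in>fst p - R. x < \<gamma>'}" by blast
    qed
    then have "countable ?A3" using low[of \<gamma>'] by (rule countable_subset)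
    with A3 show False by blast
  qed
  obtain p q m where pq: "p \<in> ?A3" "q \<in> ?A3" "b p < a q"
    and m: "m \<in> T (a p)" "m \<notin> T (b q)" "max K n \<le> m"
    by (rule tower_escapes_unbounded_family[OF T unb, where b = b and N = "max K n"]) (rule that)
  then have p: "p \<in> A2" "N p = K" "snd p = n" and q: "q \<in> A2" "N q = K" "snd q = n" by auto
  let ?r = "(fst p \<union> fst q, n)"
  have inA1: "p \<in> A1" "q \<in> A1" using p q by (simp_all add: A2_def)
  then have inA: "p \<in> A" "q \<in> A" using A1(1) by blast+
  have Rsub: "R \<subseteq> fst p" "R \<subseteq> fst q" using root inA1 by blast+
  have fins: "finite (fst p)" "finite (fst q)" using fin inA by blast+
  have above: "\<rho> \<le> x" if "x \<in> fst p - R \<or> x \<in> fst q - R" for x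
    using that p q by (auto simp: A2_def)
  have "p \<noteq> q" using pq(3) ab[OF p(1)] by (metis leD)
  have "(?r, (fst p, n)) \<in> hausdorff_le T"
    unfolding hausdorff_le_iff
  proof (intro conjI ballI impI)
    fix \<xi> \<alpha> assume \<xi>: "\<xi> \<in> fst p \<union> fst q - fst p" and \<alpha>: "\<alpha> \<in> fst p" and less: "\<xi> < \<alpha>"
    have \<xi>q: "\<xi> \<in> fst q - R" using \<xi> Rsub by blast
    have "\<rho> \<le> \<xi>" using above \<xi>q by blast
    moreover have "b p < \<xi>" using pq(3) ab(3)[OF q(1) \<xi>q] by auto
    moreover have "\<alpha> < \<rho> \<or> \<alpha> \<le> b p" using \<alpha> \<rho> ab(3)[OF p(1)] by blast
    ultimately show "\<not> T \<xi> - T \<alpha> \<subseteq> {..<n}" using less by auto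
  qed (use fins in auto)
  moreover have "(?r, (fst q, n)) \<in> hausdorff_le T"
    unfolding hausdorff_le_iff
  proof (intro conjI ballI impI)
    fix \<xi> \<alpha> assume \<xi>: "\<xi> \<in> fst p \<union> fst q - fst q" and \<alpha>: "\<alpha> \<in> fst q" and less: "\<xi> < \<alpha>"
    have \<xi>p: "\<xi> \<in> fst p - R" using \<xi> Rsub by blast
    then have "\<rho> \<le> \<xi>" using above by blast
    then have \<alpha>q: "\<alpha> \<in> fst q - R" using \<alpha> less \<rho>[of \<alpha>] by auto
    (* Beyond N p = N q = K, T at a p is below T at \<xi>, and T at \<alpha> is below T at b q. *)
    have "m \<in> T \<xi>" using N[of p "a p" \<xi> m] p m ab[OF p(1)] \<xi>p by auto
    moreover have "m \<notin> T \<alpha>" using N[of q \<alpha> "b q" m] q m ab[OF q(1)] \<alpha>q by auto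
    ultimately show "\<not> T \<xi> - T \<alpha> \<subseteq> {..<n}" using m by auto
  qed (use fins in auto)
  moreover have "?r \<in> hausdorff_conditions" using fins by simp
  moreover have "p = (fst p, n)" "q = (fst q, n)" using p q by (simp_all add: prod_eq_iff)
  ultimately have "compatible hausdorff_conditions (hausdorff_le T) p q"
    unfolding compatible_def by metis
  with anti inA \<open>p \<noteq> q\<close> show False by blast
qed

lemma dense_in_hausdorff_le:
  "dense_in hausdorff_conditions (hausdorff_le T)
     {(F, n). finite F \<and> k \<le> n \<and> (\<exists>\<delta>\<in>F. \<gamma> < \<delta>)}"
  unfolding dense_in_def
proof (intro conjI ballI)
  fix p assume "p \<in> hausdorff_conditions"
  then obtain F n where p: "p = (F, n)" "finite F" by (cases p) auto
  have "countable (insert \<gamma> F)" using p by (simp add: countable_finite)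
  then obtain \<delta> where \<delta>: "\<And>\<beta>. \<beta> \<in> insert \<gamma> F \<Longrightarrow> \<beta> < \<delta>"
    using countable_imp_bounded_omega1 by blast
  then have "((insert \<delta> F, max n k), p) \<in> hausdorff_le T"
    using p \<delta> by (auto simp: hausdorff_le_iff dest: less_asym)
  then show "\<exists>d\<in>{(F, n). finite F \<and> k \<le> n \<and> (\<exists>\<delta>\<in>F. \<gamma> < \<delta>)}. (d, p) \<in> hausdorff_le T"
    using \<delta> p by (intro bexI[of _ "(insert \<delta> F, max n k)"]) auto
qed auto

text \<open>A set of conditions of size \<open>\<omega>\<^sub>1\<close> can be copied into every type that contains a copy of
  \<open>\<omega>\<^sub>1\<close>.\<close>

lemma hausdorff_conditions_lepoll_omega1:
  "hausdorff_conditions \<lesssim> (UNIV :: omega1 set)"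
proof -
  have inf: "infinite (UNIV :: omega1 set)"
    using omega1_uncountable countable_finite by blast
  have "Fpow (UNIV :: omega1 set) \<lesssim> (UNIV :: omega1 set)"
    using eqpoll_Fpow[OF inf] by (rule eqpoll_imp_lepoll)
  moreover have "(UNIV :: nat set) \<lesssim> (UNIV :: omega1 set)"
    using inf by (simp add: infinite_le_lepoll)
  ultimately have "hausdorff_conditions \<lesssim> (UNIV :: omega1 set) \<times> (UNIV :: omega1 set)"
    unfolding hausdorff_conditions_def by (rule times_lepoll_mono)
  also have "\<dots> \<approx> (UNIV :: omega1 set)"
    using card_of_Times_same_infinite[OF inf] by (simp only: eqpoll_iff_card_of_ordIso)
  finally show ?thesis .
qed

text \<open>A common extension \<open>(E, k)\<close> of the two given conditions is in the filter and has \<open>\<alpha> \<in> E\<close> and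
  \<open>k \<ge> n\<close>. An offending \<open>\<xi>\<close> outside \<open>E\<close> would break the promise of \<open>(E, k)\<close>, because the filter
  also contains an extension of \<open>(E, k)\<close> whose set contains \<open>\<xi>\<close>.\<close>

lemma finite_traces_in_filter_union:
  assumes G: "filter_in hausdorff_conditions (hausdorff_le T) G"
    and pq: "(F, m) \<in> G" "\<alpha> \<in> F" "(F', n) \<in> G"
  shows "finite {\<xi> \<in> \<Union>(fst ` G). \<xi> < \<alpha> \<and> T \<xi> - T \<alpha> \<subseteq> {..<n}}"
proof -
  have directed: "\<exists>r\<in>G. (r, p) \<in> hausdorff_le T \<and> (r, q) \<in> hausdorff_le T" if "p \<in> G" "q \<in> G" for p q
    using G that by (simp add: filter_in_def)
  obtain E k where E: "(E, k) \<in> G" "((E, k), (F, m)) \<in> hausdorff_le T" "((E, k), (F', n)) \<in> hausdorff_le T"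
    using directed[OF pq(1,3)] by auto
  have "{\<xi> \<in> \<Union>(fst ` G). \<xi> < \<alpha> \<and> T \<xi> - T \<alpha> \<subseteq> {..<n}} \<subseteq> E"
  proof clarsimp
    fix \<xi> H j assume \<xi>: "(H, j) \<in> G" "\<xi> \<in> H" "\<xi> < \<alpha>" "T \<xi> - T \<alpha> \<subseteq> {..<n}"
    obtain H' i where H': "((H', i), (E, k)) \<in> hausdorff_le T" "((H', i), (H, j)) \<in> hausdorff_le T"
      using directed[OF E(1) \<xi>(1)] by auto
    have "T \<xi> - T \<alpha> \<subseteq> {..<k}" using \<xi>(4) E(3) by (force simp: hausdorff_le_iff)
    moreover have "\<alpha> \<in> E" using E pq by (auto simp: hausdorff_le_iff)
    moreover have "\<xi> \<in> H'" using \<xi> H' by (auto simp: hausdorff_le_iff)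
    ultimately show "\<xi> \<in> E" using H'(1) \<xi>(3) by (auto simp: hausdorff_le_iff)
  qed
  moreover have "finite E" using E by (simp add: hausdorff_le_iff)
  ultimately show ?thesis by (rule finite_subset)
qed

section \<open>Every tower is Hausdorff\<close>

theorem corollary19:
  fixes T :: "omega1 \<Rightarrow> nat set"
  assumes large: "\<exists>f :: omega1 \<Rightarrow> 'p. inj f"
    and MA: "MA_omega1 TYPE('p)"
    and T: "tower T"
  shows "hausdorff_tower T"
proof -
  let ?P = hausdorff_conditions and ?le = "hausdorff_le T"
  obtain f :: "omega1 \<Rightarrow> 'p" where f: "inj f" using large by blast
  obtain g :: "omega1 set \<times> nat \<Rightarrow> omega1" where g: "inj_on g ?P"
    using hausdorff_conditions_lepoll_omega1 by (auto simp: lepoll_def)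
  have inj: "inj_on (f \<circ> g) ?P" using f g by (meson comp_inj_on inj_on_subset subset_UNIV)
  have "infinite (UNIV :: omega1 set)" using omega1_uncountable countable_finite by blast
  then obtain i :: "nat \<Rightarrow> omega1" where i: "inj i"
    using infinite_countable_subset by blast
  (* The inverse of i maps onto nat, so this one family of dense sets serves both purposes:
     an index above each \<gamma>, and a number above each n. *)
  define D where "D \<gamma> = {(F, n). finite F \<and> inv_into UNIV i \<gamma> \<le> n \<and> (\<exists>\<delta>\<in>F. \<gamma> < \<delta>)}" for \<gamma>
  have dense: "dense_in ?P ?le (D \<gamma>)" for \<gamma>
    unfolding D_def by (rule dense_in_hausdorff_le)
  have "?P \<noteq> {}" using hausdorff_conditions_iff[of "{}" 0] by blast
  then obtain G where G: "filter_in ?P ?le G" and meets: "\<And>\<gamma>. G \<inter> D \<gamma> \<noteq> {}"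
    by (rule MA_omega1_transfer[OF MA inj _ partial_order_on_hausdorff_le ccc_hausdorff_le[OF T] dense])
      (rule that)
  define X where "X = \<Union>(fst ` G)"
  have "\<exists>x\<in>X. \<gamma> < x" for \<gamma>
  proof -
    obtain F n where "(F, n) \<in> G" "(F, n) \<in> D \<gamma>" using meets[of \<gamma>] by auto
    then show ?thesis unfolding X_def D_def by force
  qed
  then have "\<exists>e :: omega1 \<Rightarrow> omega1. strict_mono e \<and> range e \<subseteq> X"
    by (rule strict_mono_into_unbounded_omega1)
  then obtain e :: "omega1 \<Rightarrow> omega1" where e: "strict_mono e" "range e \<subseteq> X" by blast
  have "condition_H (\<lambda>\<alpha>. T (e \<alpha>))"
    unfolding condition_H_def
  proof (intro allI)
    fix \<alpha> n
    obtain F m where F: "(F, m) \<in> G" "e \<alpha> \<in> F" using e(2) unfolding X_def by fastforce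
    obtain F' k where k: "(F', k) \<in> G" "(F', k) \<in> D (i n)"
      using meets[of "i n"] by auto
    have "n \<le> k" using k(2) i by (simp add: D_def)
    have "finite {\<xi> \<in> X. \<xi> < e \<alpha> \<and> T \<xi> - T (e \<alpha>) \<subseteq> {..<k}}" (is "finite ?S")
      unfolding X_def by (rule finite_traces_in_filter_union[OF G F k(1)])
    moreover have "e ` {\<xi>. \<xi> < \<alpha> \<and> T (e \<xi>) - T (e \<alpha>) \<subseteq> {..<n}} \<subseteq> ?S"
      using e \<open>n \<le> k\<close> by (force simp: strict_mono_less)
    ultimately show "finite {\<xi>. \<xi> < \<alpha> \<and> T (e \<xi>) - T (e \<alpha>) \<subseteq> {..<n}}"
      using e(1) by (meson finite_imageD finite_subset inj_on_subset strict_mono_imp_inj_on subset_UNIV)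
  qed
  moreover have "uncountable (range e)"
    using omega1_uncountable e(1) by (metis countable_image_inj_on strict_mono_imp_inj_on)
  ultimately show ?thesis
    using T e(1) unfolding hausdorff_tower_def by blast
qed

end
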